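(* Let $X$ be a finite set and let $f:2^X\to\mathbb{R}$ be a set function with $f(\emptyset)=0$. Then $f$ is strongly submodular if and only if there is $k\ge1$, a map $\phi:X\to\mathbb{R}^k$ and a $k$-dimensional simplex $K\subseteq\mathbb{R}^k$ such that for all $A\subseteq X$, $$f(A)=R(\phi(A)\cup\{0\},K)=\inf\{\lambda\ge0:\phi(A)\cup\{0\}\subseteq\lambda K+z\text{ for some }z\in\mathbb{R}^k\}.$$
   Context: For a finite set $X$, a function $f:2^X\to\mathbb{R}$ is strongly submodular if $$\sum_{I\subseteq\{1,\ldots,m\}}(-1)^{|I|}f\Big(A_0\cup\bigcup_{i\in I}A_i\Big)\le 0$$ for all $m\ge 1$ and all $A_0,A_1,\ldots,A_m\in 2^X$. For a compact convex set $K\subseteq\mathbb{R}^k$ with nonempty interior and a bounded set $S\subseteq\mathbb{R}^k$, the generalized circumradius is $R(S,K)=\inf\{\lambda\ge0:S\subseteq\lambda K+z\text{ for some }z\in\mathbb{R}^k\}$. A $k$-dimensional simplex in $\mathbb{R}^k$ is the convex hull of $k+1$ affinely independent points. $\phi(A)=\{\phi(a):a\in A\}$, and $\phi$ need not be injective. *)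

theory Defs
  imports "HOL-Analysis.Analysis" "HOL-Analysis.Finite_Function_Topology"
begin

definition strongly_submodular :: "'a set \<Rightarrow> ('a set \<Rightarrow> real) \<Rightarrow> bool" where
  "strongly_submodular X f \<longleftrightarrow>
     (\<forall>m\<ge>1. \<forall>A :: nat \<Rightarrow> 'a set. (\<forall>i\<le>m. A i \<subseteq> X) \<longrightarrow>
        (\<Sum>I\<in>Pow {1..m}. (-1) ^ card I * f (A 0 \<union> (\<Union>i\<in>I. A i))) \<le> 0)"

text \<open>
  The space $\mathbb{R}^k$ for a dimension \<open>k\<close> that is bound inside a formula, hence cannot be a
  type: the finitely supported real sequences whose support lies in \<open>{..<k}\<close>. The ambient type is
  a \<open>real_vector\<close>, so \<open>affine_dependent\<close> and \<open>convex hull\<close> are the library notions. The lemmas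
  below confirm that this is a vector space of dimension \<open>k\<close> with coordinatewise operations.
\<close>

definition Rn :: "nat \<Rightarrow> (nat \<Rightarrow>\<^sub>0 real) set" where
  "Rn k = {x. Poly_Mapping.keys x \<subseteq> {..<k}}"

definition k_simplex :: "nat \<Rightarrow> (nat \<Rightarrow>\<^sub>0 real) set \<Rightarrow> bool" where
  "k_simplex k K \<longleftrightarrow>
     (\<exists>V \<subseteq> Rn k. finite V \<and> card V = k + 1 \<and> \<not> affine_dependent V \<and> K = convex hull V)"

text \<open>
  The infimum is taken in \<^typ>\<open>real\<close>, so it is meaningful only when some \<open>\<lambda>\<close> is admissible; this
  holds for bounded \<open>S\<close> and \<open>K\<close> with nonempty interior in $\mathbb{R}^k$, in particular for finite
  \<open>S\<close> and \<open>K\<close> a \<open>k\<close>-dimensional simplex.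
\<close>

definition gen_circumradius :: "nat \<Rightarrow> (nat \<Rightarrow>\<^sub>0 real) set \<Rightarrow> (nat \<Rightarrow>\<^sub>0 real) set \<Rightarrow> real" where
  "gen_circumradius k S K =
     Inf {l. l \<ge> 0 \<and> (\<exists>z\<in>Rn k. S \<subseteq> (\<lambda>x. l *\<^sub>R x + z) ` K)}"

lemma lookup_scaleR_poly_mapping:
  "Poly_Mapping.lookup (c *\<^sub>R (x :: nat \<Rightarrow>\<^sub>0 real)) i = c * Poly_Mapping.lookup x i"
proof -
  have "finite {i. c *\<^sub>R Poly_Mapping.lookup x i \<noteq> 0}"
    by (rule finite_subset[OF _ finite_lookup[of x]]) auto
  then show ?thesis
    by (simp add: scaleR_poly_mapping_def Abs_poly_mapping_inverse)
qed

lemma mem_Rn_iff: "x \<in> Rn k \<longleftrightarrow> (\<forall>i\<ge>k. Poly_Mapping.lookup x i = 0)"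
  by (auto simp: Rn_def subset_iff in_keys_iff not_less[symmetric])

lemma subspace_Rn: "subspace (Rn k)"
  by (auto simp: subspace_def mem_Rn_iff lookup_add lookup_scaleR_poly_mapping)

lemma dim_Rn: "dim (Rn k) = k"
proof -
  let ?e = "\<lambda>i::nat. Poly_Mapping.single i (1::real)"
  have inj: "inj_on ?e A" for A
    by (auto intro!: inj_onI simp: poly_mapping_eq_iff fun_eq_iff lookup_single when_def split: if_splits)
  have lookup_sum': "Poly_Mapping.lookup (\<Sum>i<k. u i *\<^sub>R ?e i) j = (if j < k then u j else 0)"
    for u :: "nat \<Rightarrow> real" and j
    by (simp add: Poly_Mapping.lookup_sum lookup_scaleR_poly_mapping lookup_single when_def
        if_distrib[where f = "\<lambda>z. _ * z"] cong: if_cong)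
  have "independent (?e ` {..<k})"
  proof (rule independent_if_scalars_zero)
    fix u y
    assume 0: "(\<Sum>y\<in>?e ` {..<k}. u y *\<^sub>R y) = 0" and y: "y \<in> ?e ` {..<k}"
    then obtain j where j: "j < k" "y = ?e j"
      by auto
    have "(\<Sum>i<k. u (?e i) *\<^sub>R ?e i) = 0"
      using 0 by (simp add: sum.reindex[OF inj])
    then show "u y = 0"
      using lookup_sum'[of "\<lambda>i. u (?e i)" j] j by simp
  qed auto
  moreover have "?e ` {..<k} \<subseteq> Rn k"
    by (auto simp: mem_Rn_iff lookup_single when_def)
  moreover have "Rn k \<subseteq> span (?e ` {..<k})"
  proof
    fix x assume x: "x \<in> Rn k"
    have "x = (\<Sum>i<k. Poly_Mapping.lookup x i *\<^sub>R ?e i)"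
      using x by (intro poly_mapping_eqI) (auto simp: lookup_sum' mem_Rn_iff)
    also have "\<dots> \<in> span (?e ` {..<k})"
      by (intro span_sum span_scale span_base) auto
    finally show "x \<in> span (?e ` {..<k})" .
  qed
  ultimately show ?thesis
    using dim_unique[of "?e ` {..<k}" "Rn k" k] by (simp add: card_image[OF inj])
qed

end

theory Submission
  imports Defs
begin

text \<open>
  Both sides of the equivalence describe the sums of functions
  \<open>A \<mapsto> max (0, max {g a | a \<in> A})\<close> with real weights \<open>g\<close> on \<open>X\<close>.

  Geometry. A simplex with vertex set \<open>V\<close> gives each vector \<open>x\<close> unique coordinates \<open>\<beta> v x\<close>
  with \<open>(\<Sum>v\<in>V. \<beta> v x) = 0\<close> and \<open>(\<Sum>v\<in>V. \<beta> v x *\<^sub>R v) = x\<close>. A translated and dilated copy of the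
  simplex is cut out by one lower bound on each \<open>\<beta> v\<close>, and its size is fixed by the sum of these
  bounds. The smallest copy around \<open>S\<close> makes all of the bounds tight, hence its size is
  \<open>\<Sum>v\<in>V. max {- \<beta> v s | s \<in> S}\<close> (\<open>gen_circumradius_simplex\<close>). For \<open>S = \<phi> ` A \<union> {0}\<close> each
  summand is \<open>max (0, max {g a | a \<in> A})\<close> with \<open>g a = - \<beta> v (\<phi> a)\<close>. Conversely, weights \<open>g v\<close>
  come from some \<open>\<phi>\<close> exactly when \<open>(\<Sum>v\<in>V. g v a) = 0\<close> for every \<open>a\<close>.

  From circumradius to submodularity. The summands turn unions into maxima, and the alternating
  sum of such a function \<open>h\<close> telescopes to \<open>h A\<^sub>0 - max (h A\<^sub>0) (MIN i. h A\<^sub>i)\<close>, which is at most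
  \<open>0\<close> (\<open>alternating_sum_maxitive\<close>).

  From submodularity to circumradius. By Moebius inversion a strongly submodular \<open>f\<close> with
  \<open>f {} = 0\<close> is a combination of the functions that test whether \<open>A\<close> meets \<open>B\<close>; the
  coefficient \<open>c B\<close> is the negative of an alternating sum that strong submodularity bounds by
  \<open>0\<close>, so \<open>c B \<ge> 0\<close> for nonempty \<open>B\<close> (\<open>strongly_submodular_coverage\<close>). The summand of \<open>B\<close> is
  the maximum of the weight \<open>c B\<close> on \<open>B\<close> and \<open>0\<close> elsewhere. One further vertex, with the
  nonpositive weight that makes the total zero at every point, contributes only zeros to the sum.
\<close>

section \<open>Coordinates of directions with respect to a simplex\<close>

lemma affinely_independent_coeffs_unique:
  fixes V :: "'v::real_vector set"
  assumes "finite V" "\<not> affine_dependent V"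
    and "(\<Sum>v\<in>V. u v) = (\<Sum>v\<in>V. w v)"
    and "(\<Sum>v\<in>V. u v *\<^sub>R v) = (\<Sum>v\<in>V. w v *\<^sub>R v)"
    and "v \<in> V"
  shows "u v = w v"
proof (rule ccontr)
  assume "u v \<noteq> w v"
  moreover have "(\<Sum>v\<in>V. u v - w v) = 0" "(\<Sum>v\<in>V. (u v - w v) *\<^sub>R v) = 0"
    using assms(3,4) by (simp_all add: sum_subtractf scaleR_diff_left)
  ultimately have "affine_dependent V"
    using assms(1,5) by (subst affine_dependent_explicit_finite)
      (auto intro!: exI[of _ "\<lambda>v. u v - w v"])
  with assms(2) show False by blast
qed

text \<open>
  A dimension count inside \<^term>\<open>Rn k\<close>: the ambient space has infinite dimension, so an extra vector
  outside the span is excluded by comparing cardinalities with a basis of \<^term>\<open>Rn k\<close>.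
\<close>
lemma independent_card_spans_Rn:
  assumes "k \<ge> 1" "I \<subseteq> Rn k" "independent I" "card I = k"
  shows "Rn k \<subseteq> span I"
proof
  fix x assume x: "x \<in> Rn k"
  have "finite I"
    using assms by (intro card_ge_0_finite) simp
  obtain C where C: "C \<subseteq> Rn k" "independent C" "Rn k \<subseteq> span C" "card C = k"
    using basis_exists[of "Rn k"] dim_Rn by metis
  have "finite C"
    using C(4) assms(1) by (intro card_ge_0_finite) simp
  show "x \<in> span I"
  proof (rule ccontr)
    assume nx: "x \<notin> span I"
    then have "independent (insert x I)" "x \<notin> I"
      using assms(3) by (auto simp: independent_insert intro: span_base)
    moreover have "insert x I \<subseteq> span C"
      using x assms(2) C(3) by auto
    ultimately have "card (insert x I) \<le> card C"
      using independent_span_bound[OF \<open>finite C\<close>] by blast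
    then show False
      using \<open>finite I\<close> \<open>x \<notin> I\<close> assms(4) C(4) by simp
  qed
qed

text \<open>
  These are the linear parts of the barycentric coordinates of the simplex on \<open>V\<close>: their sum is
  \<open>0\<close>, not \<open>1\<close>, because they measure displacements. They depend linearly on the vector; in the
  proofs this appears as uniqueness of coefficients over an affinely independent \<open>V\<close>.
\<close>
definition direction_coords :: "nat \<Rightarrow> (nat \<Rightarrow>\<^sub>0 real) set \<Rightarrow>
    ((nat \<Rightarrow>\<^sub>0 real) \<Rightarrow> (nat \<Rightarrow>\<^sub>0 real) \<Rightarrow> real) \<Rightarrow> bool" where
  "direction_coords k V \<beta> \<longleftrightarrow>
     (\<forall>x\<in>Rn k. (\<Sum>v\<in>V. \<beta> v x) = 0 \<and> (\<Sum>v\<in>V. \<beta> v x *\<^sub>R v) = x)"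

text \<open>
  The differences \<open>v - v0\<close> form a basis of \<^term>\<open>Rn k\<close>; giving \<open>v0\<close> the negative sum of the
  coefficients turns an expansion in this basis into one over \<open>V\<close> with coefficient sum \<open>0\<close>.
\<close>
lemma direction_coords_exist:
  assumes "k \<ge> 1" "V \<subseteq> Rn k" "card V = k + 1" "\<not> affine_dependent V"
  obtains \<beta> where "direction_coords k V \<beta>"
proof -
  have "finite V"
    using assms(3) by (intro card_ge_0_finite) simp
  obtain v0 where v0: "v0 \<in> V"
    using assms(3) by fastforce
  define W where "W = V - {v0}"
  have W: "finite W" "v0 \<notin> W" "V = insert v0 W" "card W = k"
    using \<open>finite V\<close> v0 assms(3) by (auto simp: W_def)
  let ?D = "(\<lambda>v. - v0 + v) ` W"
  have inj: "inj_on (\<lambda>v. - v0 + v) W"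
    by (auto intro: inj_onI)
  have "independent ?D"
    using assms(4) W affine_dependent_iff_dependent[of v0 W] by simp
  moreover have "?D \<subseteq> Rn k"
    using assms(2) v0 W subspace_Rn[of k]
    by (auto intro!: subspace_diff)
  moreover have "card ?D = k"
    using inj W(4) by (simp only: card_image)
  ultimately have span: "Rn k \<subseteq> span ?D"
    using assms(1) independent_card_spans_Rn by blast
  have "\<exists>b. (\<Sum>v\<in>V. b v) = 0 \<and> (\<Sum>v\<in>V. b v *\<^sub>R v) = x" if x: "x \<in> Rn k" for x
  proof -
    obtain u where "x = (\<Sum>d\<in>?D. u d *\<^sub>R d)"
      using span x W(1) by (auto simp: span_finite)
    then have u: "x = (\<Sum>v\<in>W. u (- v0 + v) *\<^sub>R (- v0 + v))"
      by (simp only: sum.reindex[OF inj] o_def)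
    define b where "b v = (if v = v0 then - (\<Sum>w\<in>W. u (- v0 + w)) else u (- v0 + v))" for v
    have b: "(\<Sum>v\<in>W. b v *\<^sub>R g v) = (\<Sum>v\<in>W. u (- v0 + v) *\<^sub>R g v)" for g :: "_ \<Rightarrow> nat \<Rightarrow>\<^sub>0 real"
      using W(2) by (intro sum.cong) (auto simp: b_def)
    have "(\<Sum>v\<in>W. b v) = (\<Sum>v\<in>W. u (- v0 + v))"
      using W(2) by (intro sum.cong) (auto simp: b_def)
    then have "(\<Sum>v\<in>V. b v) = 0"
      using W(1,2) by (simp add: W(3) b_def[of v0])
    moreover have "(\<Sum>v\<in>V. b v *\<^sub>R v) = x"
      using W(1,2) by (simp add: W(3) b b_def[of v0] u scaleR_add_right scaleR_diff_right
          sum.distrib sum_subtractf scaleR_sum_left)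
    ultimately show ?thesis by blast
  qed
  then obtain \<gamma> where "\<forall>x\<in>Rn k. (\<Sum>v\<in>V. \<gamma> x v) = 0 \<and> (\<Sum>v\<in>V. \<gamma> x v *\<^sub>R v) = x"
    by metis
  then show thesis
    using that[of "\<lambda>v x. \<gamma> x v"] by (simp add: direction_coords_def)
qed

section \<open>The circumradius with respect to a simplex\<close>

text \<open>
  The factor \<open>0\<close> is included: nonnegative weights with sum \<open>0\<close> all vanish, and the dilated hull
  is then the single point \<open>0\<close>.
\<close>
lemma nonneg_combination_in_scaled_convex_hull:
  fixes V :: "'v::real_vector set"
  assumes "finite V" "V \<noteq> {}" "\<And>v. v \<in> V \<Longrightarrow> w v \<ge> 0"
  shows "(\<Sum>v\<in>V. w v *\<^sub>R v) \<in> (\<lambda>x. (\<Sum>v\<in>V. w v) *\<^sub>R x) ` (convex hull V)"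
proof (cases "(\<Sum>v\<in>V. w v) = 0")
  case True
  then have "\<forall>v\<in>V. w v = 0"
    using assms by (subst (asm) sum_nonneg_eq_0_iff) auto
  then have "(\<Sum>v\<in>V. w v *\<^sub>R v) = 0" by simp
  then show ?thesis
    using assms(2) True by (auto simp: image_iff)
next
  case False
  let ?l = "\<Sum>v\<in>V. w v"
  have "?l > 0"
    using False sum_nonneg[of V w] assms(3) by force
  then have "(\<Sum>v\<in>V. (w v / ?l) *\<^sub>R v) \<in> convex hull V"
    using assms(1,3) by (subst convex_hull_finite)
      (auto intro!: exI[of _ "\<lambda>v. w v / ?l"] simp flip: sum_divide_distrib)
  moreover have "(\<Sum>v\<in>V. w v *\<^sub>R v) = ?l *\<^sub>R (\<Sum>v\<in>V. (w v / ?l) *\<^sub>R v)"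
    using False by (simp add: scaleR_sum_right)
  ultimately show ?thesis by blast
qed

text \<open>
  Writing the points of \<open>l *\<^sub>R K + z\<close> in coordinates shows that this copy of the simplex \<open>K\<close>
  contains \<open>S\<close> iff \<open>- \<beta> v s \<le> l * c v - \<beta> v z\<close> for all \<open>v\<close> and \<open>s\<close>, where \<open>c\<close> are the barycentric
  coordinates of the origin. Summing over \<open>v\<close> eliminates \<open>z\<close> and bounds \<open>l\<close> from below; choosing
  \<open>z\<close> so that every inequality is tight for some \<open>s\<close> attains the bound.
\<close>
lemma gen_circumradius_simplex:
  assumes V: "V \<subseteq> Rn k" "finite V" "V \<noteq> {}" "\<not> affine_dependent V"
    and \<beta>: "direction_coords k V \<beta>"
    and S: "S \<subseteq> Rn k" "finite S" "S \<noteq> {}"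
  shows "gen_circumradius k S (convex hull V) = (\<Sum>v\<in>V. Max ((\<lambda>s. - \<beta> v s) ` S))"
proof -
  have \<beta>0: "(\<Sum>v\<in>V. \<beta> v x) = 0" and \<beta>1: "(\<Sum>v\<in>V. \<beta> v x *\<^sub>R v) = x" if "x \<in> Rn k" for x
    using \<beta> that by (auto simp: direction_coords_def)
  obtain v0 where v0: "v0 \<in> V"
    using V(3) by blast
  \<comment> \<open>The barycentric coordinates of the origin: those of the vertex \<open>v0\<close>, displaced by \<open>- v0\<close>.\<close>
  define c where "c v = of_bool (v = v0) - \<beta> v v0" for v
  have c1: "(\<Sum>v\<in>V. c v) = 1" and c0: "(\<Sum>v\<in>V. c v *\<^sub>R v) = 0"
    using v0 V(1,2) \<beta>0[of v0] \<beta>1[of v0]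
    by (auto simp: c_def sum_subtractf scaleR_diff_left of_bool_def if_distrib
        [of "\<lambda>t. t *\<^sub>R _"] cong: if_cong)
  define M where "M v = Max ((\<lambda>s. - \<beta> v s) ` S)" for v
  have M: "- \<beta> v s \<le> M v" if "s \<in> S" for v s
    unfolding M_def using S(2) that by (intro Max_ge) auto
  define L where "L = (\<Sum>v\<in>V. M v)"
  have "gen_circumradius k S (convex hull V) = L"
    unfolding gen_circumradius_def
  proof (rule cInf_eq_minimum)
    obtain s where s: "s \<in> S" using S(3) by blast
    have "(\<Sum>v\<in>V. - \<beta> v s) \<le> L"
      unfolding L_def using M[OF s] by (rule sum_mono)
    then have L0: "L \<ge> 0"
      using \<beta>0[of s] s S(1) by (auto simp: sum_negf)
    \<comment> \<open>These coordinates make the inequality for each \<open>v\<close> tight; they are admissible because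
      their sum is \<open>L - L = 0\<close>.\<close>
    define z where "z = (\<Sum>v\<in>V. (L * c v - M v) *\<^sub>R v)"
    have "z \<in> Rn k"
      unfolding z_def using V(1) subspace_Rn[of k]
      by (intro subspace_sum subspace_scale) auto
    moreover have "s \<in> (\<lambda>x. L *\<^sub>R x + z) ` (convex hull V)" if s: "s \<in> S" for s
    proof -
      have sR: "s \<in> Rn k" using s S(1) by blast
      have "z = L *\<^sub>R (\<Sum>v\<in>V. c v *\<^sub>R v) - (\<Sum>v\<in>V. M v *\<^sub>R v)"
        by (simp add: z_def scaleR_diff_left sum_subtractf scaleR_sum_right)
      then have "s - z = (\<Sum>v\<in>V. (\<beta> v s + M v) *\<^sub>R v)"
        using \<beta>1[OF sR] by (simp add: c0 scaleR_add_left sum.distrib)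
      moreover have "(\<Sum>v\<in>V. \<beta> v s + M v) = L"
        using \<beta>0[OF sR] by (simp add: L_def sum.distrib)
      moreover have "\<beta> v s + M v \<ge> 0" for v
        using M[OF s, of v] by simp
      ultimately have "s - z \<in> (\<lambda>x. L *\<^sub>R x) ` (convex hull V)"
        using nonneg_combination_in_scaled_convex_hull[OF V(2,3), of "\<lambda>v. \<beta> v s + M v"] by simp
      then show ?thesis
        by (force simp: image_iff algebra_simps)
    qed
    ultimately show "L \<in> {l. l \<ge> 0 \<and> (\<exists>z\<in>Rn k. S \<subseteq> (\<lambda>x. l *\<^sub>R x + z) ` (convex hull V))}"
      using L0 by auto
  next
    fix l
    assume "l \<in> {l. l \<ge> 0 \<and> (\<exists>z\<in>Rn k. S \<subseteq> (\<lambda>x. l *\<^sub>R x + z) ` (convex hull V))}"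
    then obtain z where l: "l \<ge> 0" and z: "z \<in> Rn k"
      and sub: "S \<subseteq> (\<lambda>x. l *\<^sub>R x + z) ` (convex hull V)"
      by blast
    have "M v \<le> l * c v - \<beta> v z" if v: "v \<in> V" for v
    proof -
      have "- \<beta> v s \<le> l * c v - \<beta> v z" if s: "s \<in> S" for s
      proof -
        have sR: "s \<in> Rn k" using s S(1) by blast
        obtain w where w: "\<forall>v\<in>V. w v \<ge> 0" "(\<Sum>v\<in>V. w v) = 1"
          and sw: "s = l *\<^sub>R (\<Sum>v\<in>V. w v *\<^sub>R v) + z"
          using sub s V(2) by (auto simp: convex_hull_finite)
        have "(\<Sum>v\<in>V. (\<beta> v s - \<beta> v z + l * c v) *\<^sub>R v) = s - z + l *\<^sub>R (\<Sum>v\<in>V. c v *\<^sub>R v)"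
          using \<beta>1[OF sR] \<beta>1[OF z]
          by (simp add: scaleR_add_left scaleR_diff_left sum.distrib sum_subtractf
              scaleR_sum_right)
        also have "\<dots> = (\<Sum>v\<in>V. (l * w v) *\<^sub>R v)"
          by (simp add: c0 sw scaleR_sum_right)
        finally have "(\<Sum>v\<in>V. (\<beta> v s - \<beta> v z + l * c v) *\<^sub>R v) = (\<Sum>v\<in>V. (l * w v) *\<^sub>R v)" .
        moreover have "(\<Sum>v\<in>V. \<beta> v s - \<beta> v z + l * c v) = (\<Sum>v\<in>V. l * w v)"
          using \<beta>0[OF sR] \<beta>0[OF z] c1 w(2)
          by (simp add: sum.distrib sum_subtractf flip: sum_distrib_left)
        ultimately have "\<beta> v s - \<beta> v z + l * c v = l * w v"
          using affinely_independent_coeffs_unique[OF V(2,4), of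
              "\<lambda>v. \<beta> v s - \<beta> v z + l * c v" "\<lambda>v. l * w v"] v by blast
        moreover have "l * w v \<ge> 0"
          using l w(1) v by simp
        ultimately show ?thesis by linarith
      qed
      then show ?thesis
        unfolding M_def using S(2,3) by (subst Max_le_iff) auto
    qed
    then have "L \<le> (\<Sum>v\<in>V. l * c v - \<beta> v z)"
      unfolding L_def by (rule sum_mono)
    also have "\<dots> = l"
      using \<beta>0[OF z] c1 by (simp add: sum_subtractf flip: sum_distrib_left)
    finally show "L \<le> l" .
  qed
  then show ?thesis
    by (simp add: L_def M_def)
qed

section \<open>Maxitive functions are strongly submodular\<close>

lemma sum_Pow_insert:
  assumes "finite J" "j \<notin> J"
  shows "(\<Sum>I\<in>Pow (insert j J). g I) = (\<Sum>I\<in>Pow J. g I) + (\<Sum>I\<in>Pow J. g (insert j I))"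
proof -
  have "inj_on (insert j) (Pow J)"
    using assms(2) by (auto simp: inj_on_def)
  moreover have "Pow J \<inter> insert j ` Pow J = {}"
    using assms(2) by auto
  ultimately show ?thesis
    using assms(1) by (simp add: Pow_insert sum.union_disjoint sum.reindex)
qed

text \<open>
  Splitting the index sets by whether they contain \<open>j\<close> writes the sum for \<open>insert j J\<close> as the sum
  for \<open>J\<close> with base \<open>B\<close> minus the sum for \<open>J\<close> with base \<open>B \<union> A j\<close>. The induction therefore
  needs an arbitrary base, and an exact value instead of the inequality \<open>\<le> 0\<close>, since one of the
  two sums is subtracted.
\<close>
lemma alternating_sum_maxitive:
  fixes h :: "'a set \<Rightarrow> 'b::linordered_idom"
  assumes hmax: "\<And>A B. A \<subseteq> X \<Longrightarrow> B \<subseteq> X \<Longrightarrow> h (A \<union> B) = max (h A) (h B)"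
    and J: "finite J" "J \<noteq> {}" "\<And>i. i \<in> J \<Longrightarrow> A i \<subseteq> X" and "B \<subseteq> X"
  shows "(\<Sum>I\<in>Pow J. (-1) ^ card I * h (B \<union> (\<Union>i\<in>I. A i)))
       = h B - max (h B) (MIN i\<in>J. h (A i))"
  using J \<open>B \<subseteq> X\<close>
proof (induction J arbitrary: B rule: finite_ne_induct)
  case (singleton j)
  then show ?case
    using hmax[of B "A j"] by (simp add: Pow_insert)
next
  case (insert j J)
  let ?m = "MIN i\<in>J. h (A i)"
  have "(\<Sum>I\<in>Pow J. (-1) ^ card (insert j I) * h (B \<union> (\<Union>i\<in>insert j I. A i)))
      = - (\<Sum>I\<in>Pow J. (-1) ^ card I * h ((B \<union> A j) \<union> (\<Union>i\<in>I. A i)))"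
    unfolding sum_negf[symmetric]
  proof (rule sum.cong[OF refl])
    fix I assume "I \<in> Pow J"
    then have "finite I" "j \<notin> I"
      using insert.hyps by (auto intro: finite_subset)
    then show "(-1) ^ card (insert j I) * h (B \<union> (\<Union>i\<in>insert j I. A i))
        = - ((-1) ^ card I * h ((B \<union> A j) \<union> (\<Union>i\<in>I. A i)))"
      by (simp add: Un_assoc)
  qed
  then have "(\<Sum>I\<in>Pow (insert j J). (-1) ^ card I * h (B \<union> (\<Union>i\<in>I. A i)))
      = (h B - max (h B) ?m) - (h (B \<union> A j) - max (h (B \<union> A j)) ?m)"
    using insert by (simp add: sum_Pow_insert)
  also have "\<dots> = h B - max (h B) (min (h (A j)) ?m)"
    using hmax[of B "A j"] insert.prems by (auto simp: max_def min_def)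
  also have "min (h (A j)) ?m = (MIN i\<in>insert j J. h (A i))"
    using insert.hyps by simp
  finally show ?case .
qed

lemma strongly_submodular_maxitive:
  fixes h :: "'a set \<Rightarrow> real"
  assumes "\<And>A B. A \<subseteq> X \<Longrightarrow> B \<subseteq> X \<Longrightarrow> h (A \<union> B) = max (h A) (h B)"
  shows "strongly_submodular X h"
  unfolding strongly_submodular_def
proof (intro allI impI)
  fix m :: nat and A :: "nat \<Rightarrow> 'a set"
  assume m: "1 \<le> m" and A: "\<forall>i\<le>m. A i \<subseteq> X"
  have "(\<Sum>I\<in>Pow {1..m}. (-1) ^ card I * h (A 0 \<union> (\<Union>i\<in>I. A i)))
      = h (A 0) - max (h (A 0)) (MIN i\<in>{1..m}. h (A i))"
    by (rule alternating_sum_maxitive[of X h, OF assms]) (use m A in auto)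
  then show "(\<Sum>I\<in>Pow {1..m}. (-1) ^ card I * h (A 0 \<union> (\<Union>i\<in>I. A i))) \<le> 0"
    by simp
qed

lemma strongly_submodular_sum:
  fixes f :: "'a set \<Rightarrow> real"
  assumes "\<And>v. v \<in> V \<Longrightarrow> strongly_submodular X (h v)"
    and "\<And>A. A \<subseteq> X \<Longrightarrow> f A = (\<Sum>v\<in>V. h v A)"
  shows "strongly_submodular X f"
  unfolding strongly_submodular_def
proof (intro allI impI)
  fix m :: nat and A :: "nat \<Rightarrow> 'a set"
  assume m: "1 \<le> m" and A: "\<forall>i\<le>m. A i \<subseteq> X"
  have "(\<Sum>I\<in>Pow {1..m}. (-1) ^ card I * f (A 0 \<union> (\<Union>i\<in>I. A i)))
      = (\<Sum>I\<in>Pow {1..m}. \<Sum>v\<in>V. (-1) ^ card I * h v (A 0 \<union> (\<Union>i\<in>I. A i)))"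
  proof (rule sum.cong[OF refl])
    fix I assume "I \<in> Pow {1..m}"
    then have "A 0 \<union> (\<Union>i\<in>I. A i) \<subseteq> X"
      using A by fastforce
    then show "(-1) ^ card I * f (A 0 \<union> (\<Union>i\<in>I. A i))
        = (\<Sum>v\<in>V. (-1) ^ card I * h v (A 0 \<union> (\<Union>i\<in>I. A i)))"
      by (simp add: assms(2) sum_distrib_left)
  qed
  also have "\<dots> = (\<Sum>v\<in>V. \<Sum>I\<in>Pow {1..m}. (-1) ^ card I * h v (A 0 \<union> (\<Union>i\<in>I. A i)))"
    by (rule sum.swap)
  also have "\<dots> \<le> 0"
  proof (rule sum_nonpos)
    fix v assume "v \<in> V"
    from assms(1)[OF this, unfolded strongly_submodular_def, THEN spec, THEN mp, OF m,
        THEN spec, THEN mp, OF A]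
    show "(\<Sum>I\<in>Pow {1..m}. (-1) ^ card I * h v (A 0 \<union> (\<Union>i\<in>I. A i))) \<le> 0" .
  qed
  finally show "(\<Sum>I\<in>Pow {1..m}. (-1) ^ card I * f (A 0 \<union> (\<Union>i\<in>I. A i))) \<le> 0" .
qed

section \<open>Strongly submodular functions as weighted coverage functions\<close>

text \<open>
  The instance of strong submodularity for the complement of \<open>B\<close> and the singletons of \<open>B\<close>; all
  sign conditions on Moebius coefficients are of this form.
\<close>
lemma strongly_submodular_nonneg_weight:
  assumes f: "strongly_submodular X f" and "finite B" "B \<noteq> {}" "B \<subseteq> X"
  shows "(\<Sum>T\<in>Pow B. (-1) ^ card T * f ((X - B) \<union> T)) \<le> 0"
proof -
  obtain e where e: "bij_betw e {1..card B} B"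
    using ex_bij_betw_nat_finite_1[OF \<open>finite B\<close>] by blast
  let ?A = "\<lambda>i::nat. if i = 0 then X - B else {e i}"
  have eB: "e i \<in> B" if "i \<in> {1..card B}" for i
    using e that by (auto simp: bij_betw_def)
  have m: "1 \<le> card B"
    using assms(2,3) by (simp add: Suc_le_eq card_gt_0_iff)
  have "\<forall>i\<le>card B. ?A i \<subseteq> X"
    using eB assms(4) by auto
  then have "(\<Sum>I\<in>Pow {1..card B}. (-1) ^ card I * f (?A 0 \<union> (\<Union>i\<in>I. ?A i))) \<le> 0"
    using f[unfolded strongly_submodular_def, THEN spec, THEN mp, OF m, THEN spec, of ?A] by simp
  also have "(\<Sum>I\<in>Pow {1..card B}. (-1) ^ card I * f (?A 0 \<union> (\<Union>i\<in>I. ?A i)))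
      = (\<Sum>I\<in>Pow {1..card B}. (-1) ^ card (e ` I) * f ((X - B) \<union> e ` I))"
  proof (rule sum.cong[OF refl])
    fix I assume I: "I \<in> Pow {1..card B}"
    then have "inj_on e I"
      using e by (auto simp: bij_betw_def intro: inj_on_subset)
    moreover have "(\<Union>i\<in>I. ?A i) = (\<Union>i\<in>I. {e i})"
      using I by (intro SUP_cong) auto
    then have "(\<Union>i\<in>I. ?A i) = e ` I"
      by (simp only: UNION_singleton_eq_range)
    ultimately show "(-1) ^ card I * f (?A 0 \<union> (\<Union>i\<in>I. ?A i))
        = (-1) ^ card (e ` I) * f ((X - B) \<union> e ` I)"
      by (simp add: card_image)
  qed
  also have "\<dots> = (\<Sum>T\<in>Pow B. (-1) ^ card T * f ((X - B) \<union> T))"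
    by (rule sum.reindex_bij_betw[OF bij_betw_Pow[OF e]])
  finally show ?thesis .
qed

text \<open>
  Moebius inversion of \<open>E \<mapsto> f (X - E)\<close> gives coefficients \<open>c\<close> whose sum over the subsets of \<open>E\<close> is
  \<open>- f (X - E)\<close>. The sets \<open>B\<close> that meet \<open>A\<close> are those that are not subsets of \<open>X - A\<close>, so their
  coefficients sum to \<open>- f {} + f A = f A\<close>. Reversing the order of the subsets of \<open>B\<close> by
  complementation identifies \<open>- c B\<close> with the alternating sum in
  \<open>strongly_submodular_nonneg_weight\<close>.
\<close>
lemma strongly_submodular_coverage:
  assumes "finite X" "f {} = 0" "strongly_submodular X f"
  obtains c where "\<And>B. B \<subseteq> X \<Longrightarrow> B \<noteq> {} \<Longrightarrow> c B \<ge> 0"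
    and "\<And>A. A \<subseteq> X \<Longrightarrow> f A = (\<Sum>B\<in>Pow X. c B * of_bool (A \<inter> B \<noteq> {}))"
proof
  define c where "c B = - ((-1) ^ card B * (\<Sum>T\<in>Pow B. (-1) ^ card T * f (X - T)))" for B
  show "c B \<ge> 0" if B: "B \<subseteq> X" "B \<noteq> {}" for B
  proof -
    have "finite B"
      using B assms(1) finite_subset by blast
    have bij: "bij_betw (\<lambda>T. B - T) (Pow B) (Pow B)"
      by (rule bij_betwI[where g = "\<lambda>T. B - T"]) auto
    have "(-1) ^ card B * (\<Sum>T\<in>Pow B. (-1) ^ card T * f (X - T))
        = (\<Sum>T\<in>Pow B. (-1) ^ card (B - T) * f ((X - B) \<union> (B - T)))"
      unfolding sum_distrib_left
    proof (rule sum.cong[OF refl])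
      fix T assume T: "T \<in> Pow B"
      then have "X - T = (X - B) \<union> (B - T)"
        using B by auto
      moreover have "(-1::real) ^ card B * (-1) ^ card T = (-1) ^ card (B - T)"
        using T \<open>finite B\<close>
        by (simp add: card_Diff_subset finite_subset card_mono
            neg_one_power_add_eq_neg_one_power_diff flip: power_add)
      ultimately show "(-1) ^ card B * ((-1) ^ card T * f (X - T))
          = (-1) ^ card (B - T) * f ((X - B) \<union> (B - T))"
        by (metis mult.assoc)
    qed
    also have "\<dots> = (\<Sum>T\<in>Pow B. (-1) ^ card T * f ((X - B) \<union> T))"
      by (rule sum.reindex_bij_betw[OF bij])
    finally show ?thesis
      using strongly_submodular_nonneg_weight[OF assms(3) \<open>finite B\<close> B(2,1)] by (simp add: c_def)
  qed
  have below: "(\<Sum>B\<in>Pow E. c B) = - f (X - E)" if "finite E" for E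
    using inclusion_exclusion_symmetric[OF refl that, of "\<lambda>T. f (X - T)"]
    by (simp add: c_def sum_negf)
  show "f A = (\<Sum>B\<in>Pow X. c B * of_bool (A \<inter> B \<noteq> {}))" if A: "A \<subseteq> X" for A
  proof -
    have "(\<Sum>B\<in>Pow X. c B * of_bool (A \<inter> B \<noteq> {}))
        = (\<Sum>B\<in>Pow X. c B) - (\<Sum>B\<in>Pow X. c B * of_bool (A \<inter> B = {}))"
      unfolding sum_subtractf[symmetric] by (rule sum.cong) auto
    also have "(\<Sum>B\<in>Pow X. c B * of_bool (A \<inter> B = {})) = (\<Sum>B\<in>Pow (X - A). c B)"
      using assms(1) by (intro sum.mono_neutral_cong_right) auto
    also have "(\<Sum>B\<in>Pow X. c B) - (\<Sum>B\<in>Pow (X - A). c B) = f A"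
      using below[of X] below[of "X - A"] assms(1,2) A by (simp add: double_diff)
    finally show ?thesis ..
  qed
qed

section \<open>Strong submodularity and circumradii\<close>

lemma gen_circumradius_simplex_image:
  assumes V: "V \<subseteq> Rn k" "finite V" "V \<noteq> {}" "\<not> affine_dependent V"
    and \<beta>: "direction_coords k V \<beta>"
    and "finite A" "\<phi> \<in> A \<rightarrow> Rn k"
  shows "gen_circumradius k (\<phi> ` A \<union> {0}) (convex hull V)
       = (\<Sum>v\<in>V. Max (insert 0 ((\<lambda>a. - \<beta> v (\<phi> a)) ` A)))"
proof -
  have R0: "0 \<in> Rn k"
    using subspace_Rn subspace_0 by blast
  have "\<beta> v 0 = 0" if "v \<in> V" for v
    using affinely_independent_coeffs_unique[OF V(2,4), of "\<lambda>v. \<beta> v 0" "\<lambda>v. 0"] \<beta> R0 that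
    by (simp add: direction_coords_def)
  then have "(\<lambda>s. - \<beta> v s) ` (\<phi> ` A \<union> {0}) = insert 0 ((\<lambda>a. - \<beta> v (\<phi> a)) ` A)"
    if "v \<in> V" for v
    using that by (simp add: image_Un image_image)
  then show ?thesis
    using gen_circumradius_simplex[OF V \<beta>, of "\<phi> ` A \<union> {0}"] assms(6,7) R0
    by (simp add: image_subset_iff Pi_iff cong: sum.cong)
qed

lemma k_simplex_exists:
  assumes "k \<ge> 1"
  obtains V where "V \<subseteq> Rn k" "finite V" "card V = k + 1" "\<not> affine_dependent V"
proof -
  obtain B where B: "B \<subseteq> Rn k" "independent B" "card B = k"
    using basis_exists[of "Rn k"] dim_Rn by metis
  have "finite B" "0 \<notin> B"
    using B assms by (auto intro: card_ge_0_finite dest: dependent_zero)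
  then show thesis
    using B that[of "insert 0 B"] subspace_0[OF subspace_Rn] affine_dependent_iff_dependent[of 0 B]
    by simp
qed

theorem theorem20:
  fixes X :: "'a set" and f :: "'a set \<Rightarrow> real"
  assumes "finite X" and "f {} = 0"
  shows "strongly_submodular X f \<longleftrightarrow>
    (\<exists>k\<ge>1. \<exists>\<phi> K. \<phi> \<in> X \<rightarrow> Rn k \<and> k_simplex k K \<and>
       (\<forall>A\<subseteq>X. f A = gen_circumradius k (\<phi> ` A \<union> {0}) K))"
proof
  assume "strongly_submodular X f"
  then obtain c where c: "\<And>B. B \<subseteq> X \<Longrightarrow> B \<noteq> {} \<Longrightarrow> c B \<ge> 0"
    and fc: "\<And>A. A \<subseteq> X \<Longrightarrow> f A = (\<Sum>B\<in>Pow X. c B * of_bool (A \<inter> B \<noteq> {}))"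
    using strongly_submodular_coverage[of X f, OF assms] by metis
  \<comment> \<open>One vertex for each subset of \<open>X\<close>, and the vertex \<open>v0\<close> that balances the weights. Indexing by
    all subsets, the empty one included, ensures \<open>k \<ge> 1\<close> even if \<open>X\<close> is empty.\<close>
  define k :: nat where "k = card (Pow X)"
  have "k \<ge> 1"
    using assms(1) by (simp add: k_def card_Pow)
  then obtain V where V: "V \<subseteq> Rn k" "finite V" "card V = k + 1" "\<not> affine_dependent V"
    by (rule k_simplex_exists)
  then have "V \<noteq> {}" by auto
  obtain \<beta> where \<beta>: "direction_coords k V \<beta>"
    using direction_coords_exist[OF \<open>k \<ge> 1\<close> V(1,3,4)] .
  obtain v0 where v0: "v0 \<in> V"
    using \<open>V \<noteq> {}\<close> by blast
  have "card (V - {v0}) = card (Pow X)"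
    using V v0 by (simp add: k_def)
  then obtain p where p: "bij_betw p (V - {v0}) (Pow X)"
    using finite_same_card_bij[of "V - {v0}" "Pow X"] V(2) assms(1) by auto
  define s where "s a = (\<Sum>B\<in>Pow X. c B * of_bool (a \<in> B))" for a
  define g where "g v a = (if v = v0 then - s a else c (p v) * of_bool (a \<in> p v))" for v a
  have sum_V: "(\<Sum>v\<in>V. h v) = h v0 + (\<Sum>v\<in>V - {v0}. h v)" for h :: "_ \<Rightarrow> real"
    using v0 V(2) by (rule sum.remove[rotated])
  have g0: "(\<Sum>v\<in>V. g v a) = 0" for a
  proof -
    have "(\<Sum>v\<in>V - {v0}. g v a) = (\<Sum>v\<in>V - {v0}. c (p v) * of_bool (a \<in> p v))"
      by (intro sum.cong) (auto simp: g_def)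
    also have "\<dots> = s a"
      unfolding s_def by (rule sum.reindex_bij_betw[OF p])
    finally show ?thesis
      by (simp add: sum_V g_def)
  qed
  \<comment> \<open>The sign is negative since the circumradius formula involves the maxima of \<open>- \<beta> v\<close>.\<close>
  define \<phi> where "\<phi> a = (\<Sum>v\<in>V. (- g v a) *\<^sub>R v)" for a
  have \<phi>R: "\<phi> a \<in> Rn k" for a
    unfolding \<phi>_def using V(1) subspace_Rn[of k]
    by (intro subspace_sum subspace_scale) auto
  have \<beta>\<phi>: "- \<beta> v (\<phi> a) = g v a" if "v \<in> V" for v a
  proof -
    have "\<beta> v (\<phi> a) = - g v a"
      by (rule affinely_independent_coeffs_unique[OF V(2,4)])
        (use \<beta> \<phi>R[of a] g0[of a] that in
          \<open>auto simp: direction_coords_def sum_negf \<phi>_def\<close>)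
    then show ?thesis by simp
  qed
  have s0: "s a \<ge> 0" if "a \<in> X" for a
    unfolding s_def
  proof (rule sum_nonneg)
    fix B assume "B \<in> Pow X"
    then show "0 \<le> c B * of_bool (a \<in> B)"
      using c[of B] by (cases "a \<in> B") auto
  qed
  have "f A = gen_circumradius k (\<phi> ` A \<union> {0}) (convex hull V)" if A: "A \<subseteq> X" for A
  proof -
    have "finite A" using A assms(1) finite_subset by blast
    have top: "Max (insert 0 (g v ` A)) = c (p v) * of_bool (A \<inter> p v \<noteq> {})"
      if v: "v \<in> V - {v0}" for v
    proof (cases "A \<inter> p v = {}")
      case True
      then have "insert 0 (g v ` A) = {0}"
        using v by (auto simp: g_def)
      then have "Max (insert 0 (g v ` A)) = 0"
        by (simp only: Max_singleton)
      then show ?thesis using True by simp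
    next
      case False
      have "p v \<subseteq> X"
        using p v by (auto simp: bij_betw_def)
      then have "c (p v) \<ge> 0"
        using False c by auto
      moreover have "c (p v) \<in> g v ` A"
        using False v by (force simp: g_def)
      moreover have "g v ` A \<subseteq> {0, c (p v)}"
        using v by (auto simp: g_def)
      ultimately have "Max (insert 0 (g v ` A)) = c (p v)"
        using \<open>finite A\<close> by (intro Max_eqI) auto
      then show ?thesis using False by simp
    qed
    have top0: "Max (insert 0 (g v0 ` A)) = 0"
      using \<open>finite A\<close> s0 A by (intro Max_eqI) (auto simp: g_def)
    have "gen_circumradius k (\<phi> ` A \<union> {0}) (convex hull V)
        = (\<Sum>v\<in>V. Max (insert 0 ((\<lambda>a. - \<beta> v (\<phi> a)) ` A)))"
      using gen_circumradius_simplex_image[OF V(1,2) \<open>V \<noteq> {}\<close> V(4) \<beta> \<open>finite A\<close>] \<phi>R by blast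
    also have "\<dots> = (\<Sum>v\<in>V. Max (insert 0 (g v ` A)))"
      by (simp add: \<beta>\<phi> cong: sum.cong)
    also have "\<dots> = (\<Sum>v\<in>V - {v0}. c (p v) * of_bool (A \<inter> p v \<noteq> {}))"
      by (simp only: sum_V top0 top add_0 cong: sum.cong)
    also have "\<dots> = (\<Sum>B\<in>Pow X. c B * of_bool (A \<inter> B \<noteq> {}))"
      by (rule sum.reindex_bij_betw[OF p])
    finally show ?thesis
      using fc[OF A] by simp
  qed
  moreover have "k_simplex k (convex hull V)"
    unfolding k_simplex_def using V by blast
  ultimately show "\<exists>k\<ge>1. \<exists>\<phi> K. \<phi> \<in> X \<rightarrow> Rn k \<and> k_simplex k K \<and>
      (\<forall>A\<subseteq>X. f A = gen_circumradius k (\<phi> ` A \<union> {0}) K)"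
    using \<open>k \<ge> 1\<close> \<phi>R by blast
next
  assume "\<exists>k\<ge>1. \<exists>\<phi> K. \<phi> \<in> X \<rightarrow> Rn k \<and> k_simplex k K \<and>
      (\<forall>A\<subseteq>X. f A = gen_circumradius k (\<phi> ` A \<union> {0}) K)"
  then obtain k \<phi> K where k: "k \<ge> 1" and \<phi>: "\<phi> \<in> X \<rightarrow> Rn k" and K: "k_simplex k K"
    and fK: "\<And>A. A \<subseteq> X \<Longrightarrow> f A = gen_circumradius k (\<phi> ` A \<union> {0}) K"
    by blast
  obtain V where V: "V \<subseteq> Rn k" "finite V" "card V = k + 1" "\<not> affine_dependent V"
    and KV: "K = convex hull V"
    using K unfolding k_simplex_def by blast
  have "V \<noteq> {}" using V(3) by auto
  obtain \<beta> where \<beta>: "direction_coords k V \<beta>"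
    using direction_coords_exist[OF k V(1,3,4)] .
  let ?h = "\<lambda>v A. Max (insert 0 ((\<lambda>a. - \<beta> v (\<phi> a)) ` A))"
  show "strongly_submodular X f"
  proof (rule strongly_submodular_sum[where h = ?h and V = V])
    fix v
    show "strongly_submodular X (?h v)"
    proof (rule strongly_submodular_maxitive)
      fix A B assume "A \<subseteq> X" "B \<subseteq> X"
      then have "finite A" "finite B"
        using assms(1) finite_subset by blast+
      then show "?h v (A \<union> B) = max (?h v A) (?h v B)"
        by (subst Max_Un[symmetric]) (auto simp: image_Un)
    qed
  next
    fix A assume A: "A \<subseteq> X"
    then have "finite A" "\<phi> \<in> A \<rightarrow> Rn k"
      using assms(1) \<phi> finite_subset by blast+
    then show "f A = (\<Sum>v\<in>V. ?h v A)"
      using gen_circumradius_simplex_image[OF V(1,2) \<open>V \<noteq> {}\<close> V(4) \<beta>] fK[OF A] KV by simp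
  qed
qed

end
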